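(* Let $k\ge1$ be an integer. There is no set $\mathcal{F}$ of maps (forbidden submaps) such that for every map $\varepsilon\colon X^{\times}_{\mathrm{irr}}\to\mathcal{P}(M)$ (over arbitrary finite nonempty $X$ and $M$), $\varepsilon$ is a $k$-restricted Fitch map if and only if $\varepsilon$ does not contain a submap belonging to $\mathcal{F}$.
   Context: For finite nonempty sets $X$ (leaves) and $M$ (colors), $X^{\times}_{\mathrm{irr}}=\{(x,y)\in X\times X: x\neq y\}$. A phylogenetic tree on $X$ is a rooted tree whose leaves (non-root vertices of degree $1$) form $X$, whose root has degree $\ge2$ and whose non-root inner vertices have degree $\ge3$; $\mathrm{lca}(x,y)$ is the last common ancestor. An edge-labeled tree $(T,\lambda)$ on $X$ with $M$ is a phylogenetic tree $T$ on $X$ with $\lambda\colon E(T)\to\mathcal{P}(M)$; $e$ is an $m$-edge if $m\in\lambda(e)$. $(T,\lambda)$ explains $\varepsilon\colon X^{\times}_{\mathrm{irr}}\to\mathcal{P}(M)$ if for all $(x,y)\in X^{\times}_{\mathrm{irr}}$, $m\in M$: $m\in\varepsilon(x,y)$ iff the path from $\mathrm{lca}(x,y)$ to $y$ contains an $m$-edge; $\varepsilon$ is a $k$-restricted Fitch map if some edge-labeled tree $(T,\lambda)$ with $|\lambda(e)|\le k$ for all $e\in E(T)$ explains it. A map $\varepsilon'\colon X'^{\times}_{\mathrm{irr}}\to\mathcal{P}(M')$ is a submap of $\varepsilon$ if $X'\subseteq X$ and $\varepsilon'(x,y)\subseteq\varepsilon(x,y)$ for all $(x,y)\in X'^{\times}_{\mathrm{irr}}$.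 *)

theory Defs
  imports "Graph_Theory.Graph_Theory" "HOL-Library.FuncSet" "HOL-Library.Infinite_Typeclass"
begin

definition irr :: "'x set \<Rightarrow> ('x \<times> 'x) set" where
  "irr X = {(x, y). x \<in> X \<and> y \<in> X \<and> x \<noteq> y}"

text \<open>
  Edges are directed away from the root. The constant \<^const>\<open>tree\<close> of the library is not used: it
  only excludes directed cycles and so admits vertices with several parents. Since walks may repeat
  vertices, uniqueness of the walk from the root also excludes directed cycles.
\<close>

definition rooted_tree :: "'v pair_pre_digraph \<Rightarrow> 'v \<Rightarrow> bool" where
  "rooted_tree T r \<longleftrightarrow> pair_fin_digraph T \<and> r \<in> pverts T \<and>
     (\<forall>v \<in> pverts T. \<exists>!p. pre_digraph.awalk (with_proj T) r p v)"

definition vdegree :: "'v pair_pre_digraph \<Rightarrow> 'v \<Rightarrow> nat" where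
  "vdegree T v = in_degree (with_proj T) v + out_degree (with_proj T) v"

definition leaves :: "'v pair_pre_digraph \<Rightarrow> 'v \<Rightarrow> 'v set" where
  "leaves T r = {v \<in> pverts T. v \<noteq> r \<and> vdegree T v = 1}"

text \<open>
  The first alternative is the usual convention for a one-element leaf set: the single-vertex tree,
  whose root is at the same time its leaf. Without it there would be no phylogenetic tree at all on
  a singleton, although every map on a singleton is vacuously explained.
\<close>

definition phylogenetic_tree :: "'v pair_pre_digraph \<Rightarrow> 'v \<Rightarrow> 'v set \<Rightarrow> bool" where
  "phylogenetic_tree T r X \<longleftrightarrow> rooted_tree T r \<and>
     (pverts T = {r} \<and> X = {r} \<or>
      leaves T r = X \<and> 2 \<le> vdegree T r \<and>
      (\<forall>v \<in> pverts T. v \<noteq> r \<and> v \<notin> leaves T r \<longrightarrow> 3 \<le> vdegree T v))"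

definition lca :: "'v pair_pre_digraph \<Rightarrow> 'v \<Rightarrow> 'v \<Rightarrow> 'v" where
  "lca T x y = (THE u. u \<rightarrow>\<^sup>*\<^bsub>with_proj T\<^esub> x \<and> u \<rightarrow>\<^sup>*\<^bsub>with_proj T\<^esub> y \<and>
     (\<forall>w. w \<rightarrow>\<^sup>*\<^bsub>with_proj T\<^esub> x \<and> w \<rightarrow>\<^sup>*\<^bsub>with_proj T\<^esub> y \<longrightarrow> w \<rightarrow>\<^sup>*\<^bsub>with_proj T\<^esub> u))"

definition edge_labeled_tree ::
  "'v pair_pre_digraph \<Rightarrow> 'v \<Rightarrow> ('v \<times> 'v \<Rightarrow> 'm set) \<Rightarrow> 'v set \<Rightarrow> 'm set \<Rightarrow> bool" where
  "edge_labeled_tree T r l X M \<longleftrightarrow> phylogenetic_tree T r X \<and> l \<in> parcs T \<rightarrow> Pow M"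

text \<open>
  A map from pairs of distinct elements of \<open>X\<close> to subsets of \<open>M\<close> is recorded together with \<open>X\<close> and
  \<open>M\<close>; extensionality outside its domain makes equality of records equality of maps.
\<close>

record ('x, 'm) pair_map =
  leaf_set :: "'x set"
  colors :: "'m set"
  eps :: "'x \<times> 'x \<Rightarrow> 'm set"

definition is_pair_map :: "('x, 'm) pair_map \<Rightarrow> bool" where
  "is_pair_map f \<longleftrightarrow> finite (leaf_set f) \<and> leaf_set f \<noteq> {} \<and> finite (colors f) \<and> colors f \<noteq> {} \<and>
     eps f \<in> irr (leaf_set f) \<rightarrow>\<^sub>E Pow (colors f)"

definition explains ::
  "'x pair_pre_digraph \<Rightarrow> ('x \<times> 'x \<Rightarrow> 'm set) \<Rightarrow> ('x, 'm) pair_map \<Rightarrow> bool" where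
  "explains T l f \<longleftrightarrow> (\<forall>(x, y) \<in> irr (leaf_set f). \<forall>m \<in> colors f.
     m \<in> eps f (x, y) \<longleftrightarrow>
     (\<exists>p. pre_digraph.awalk (with_proj T) (lca T x y) p y \<and> (\<exists>e \<in> set p. m \<in> l e)))"

text \<open>
  Tree vertices are taken from the type of the leaves, so that the leaf set of the tree can be \<open>X\<close>
  itself; as that type is infinite, it contains enough inner vertices for every finite tree.
\<close>

definition restricted_fitch_map :: "nat \<Rightarrow> ('x::infinite, 'm) pair_map \<Rightarrow> bool" where
  "restricted_fitch_map k f \<longleftrightarrow> is_pair_map f \<and>
     (\<exists>T r l. edge_labeled_tree T r l (leaf_set f) (colors f) \<and>
        (\<forall>e \<in> parcs T. card (l e) \<le> k) \<and> explains T l f)"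

definition submap :: "('x, 'm) pair_map \<Rightarrow> ('x, 'm) pair_map \<Rightarrow> bool" where
  "submap g f \<longleftrightarrow> leaf_set g \<subseteq> leaf_set f \<and> (\<forall>e \<in> irr (leaf_set g). eps g e \<subseteq> eps f e)"

end

theory Submission
  imports Defs
begin

text \<open>
  A class of maps characterised by forbidden submaps is closed under taking submaps. The constant
  map with value \<open>{m}\<close> on three leaves is explained by a star all of whose edges carry the label
  \<open>{m}\<close>, and every map on the same leaves with the single color \<open>m\<close> is a submap of it. Not all of
  these are Fitch maps: if the path from \<open>lca(a, b)\<close> to \<open>b\<close> has an \<open>m\<close>-edge but the path from
  \<open>lca(c, b)\<close> to \<open>b\<close> has none, then \<open>lca(c, b)\<close> lies below \<open>lca(a, b)\<close> with an \<open>m\<close>-edge in between,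
  and that edge also lies on the path from \<open>lca(a, c)\<close> to \<open>c\<close>.
\<close>

locale arborescence = pair_fin_digraph G for G :: "'v pair_pre_digraph" +
  fixes root :: 'v
  assumes root_in_verts: "root \<in> pverts G"
    and unique_root_walk: "v \<in> pverts G \<Longrightarrow> \<exists>!p. awalk root p v"
begin

lemma root_walk_eq: "awalk root p v \<Longrightarrow> awalk root q v \<Longrightarrow> p = q"
  using unique_root_walk awalk_last_in_verts by blast

lemma root_walk_exists: "v \<in> pverts G \<Longrightarrow> \<exists>p. awalk root p v"
  using unique_root_walk by blast

lemma awalk_unique:
  assumes "awalk u p v" "awalk u q v"
  shows "p = q"
proof -
  obtain s where "awalk root s u"
    using root_walk_exists assms(1) awalk_hd_in_verts by blast
  then have "s @ p = s @ q"
    using assms awalk_appendI root_walk_eq by blast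
  then show ?thesis by simp
qed

lemma closed_awalk_Nil: "awalk u p u \<Longrightarrow> p = []"
  by (meson awalk_Nil_iff awalk_hd_in_verts awalk_unique)

lemma reachable_antisym:
  assumes "u \<rightarrow>\<^sup>*\<^bsub>with_proj G\<^esub> v" "v \<rightarrow>\<^sup>*\<^bsub>with_proj G\<^esub> u"
  shows "u = v"
proof -
  obtain p q where p: "awalk u p v" and q: "awalk v q u"
    using assms reachable_awalk by blast
  then have "p @ q = []"
    using awalk_appendI closed_awalk_Nil by blast
  then show ?thesis using p by (simp add: awalk_Nil_iff)
qed

lemma ancestors_comparable:
  assumes "u \<rightarrow>\<^sup>*\<^bsub>with_proj G\<^esub> x" "w \<rightarrow>\<^sup>*\<^bsub>with_proj G\<^esub> x"
  shows "u \<rightarrow>\<^sup>*\<^bsub>with_proj G\<^esub> w \<or> w \<rightarrow>\<^sup>*\<^bsub>with_proj G\<^esub> u"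
proof -
  have prefix_reachable: "u' \<rightarrow>\<^sup>*\<^bsub>with_proj G\<^esub> w'"
    if "awalk root s u'" "awalk root (s @ t) w'" for u' w' s t
  proof -
    have "awalk (last (pawalk_verts root s)) t w'" "awalk root s (last (pawalk_verts root s))"
      using that(2) by auto
    moreover have "last (pawalk_verts root s) = u'"
      using that(1) by auto
    ultimately show ?thesis using reachable_awalk by blast
  qed
  obtain p q where p: "awalk u p x" and q: "awalk w q x"
    using assms reachable_awalk by blast
  obtain s t where s: "awalk root s u" and t: "awalk root t w"
    using p q root_walk_exists awalk_hd_in_verts by meson
  have "s @ p = t @ q"
    using p q s t awalk_appendI root_walk_eq by blast
  then obtain d where "s @ d = t \<or> s = t @ d"
    by (auto simp: append_eq_append_conv2)
  then show ?thesis
    using prefix_reachable s t by blast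
qed

lemma lca_exists:
  assumes "x \<in> pverts G" "y \<in> pverts G"
  shows "\<exists>u. u \<rightarrow>\<^sup>*\<^bsub>with_proj G\<^esub> x \<and> u \<rightarrow>\<^sup>*\<^bsub>with_proj G\<^esub> y \<and>
     (\<forall>w. w \<rightarrow>\<^sup>*\<^bsub>with_proj G\<^esub> x \<and> w \<rightarrow>\<^sup>*\<^bsub>with_proj G\<^esub> y \<longrightarrow> w \<rightarrow>\<^sup>*\<^bsub>with_proj G\<^esub> u)"
proof -
  define A where "A = {w. w \<rightarrow>\<^sup>*\<^bsub>with_proj G\<^esub> x \<and> w \<rightarrow>\<^sup>*\<^bsub>with_proj G\<^esub> y}"
  define below where "below w = {v \<in> A. w \<rightarrow>\<^sup>*\<^bsub>with_proj G\<^esub> v}" for w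
  have A_verts: "A \<subseteq> pverts G"
    unfolding A_def using reachable_awalk awalk_hd_in_verts by blast
  have finite_A: "finite A"
    using A_verts pair_finite_verts finite_subset by blast
  have "root \<in> A"
    unfolding A_def using assms root_walk_exists reachable_awalk by blast
  then obtain u where u: "u \<in> A" and min: "\<And>w. w \<in> A \<Longrightarrow> card (below u) \<le> card (below w)"
    using ex_has_least_nat[of "\<lambda>w. w \<in> A" root "\<lambda>w. card (below w)"] by blast
  have "w \<rightarrow>\<^sup>*\<^bsub>with_proj G\<^esub> u" if w: "w \<in> A" for w
  proof (rule ccontr)
    assume nw: "\<not> w \<rightarrow>\<^sup>*\<^bsub>with_proj G\<^esub> u"
    then have uw: "u \<rightarrow>\<^sup>*\<^bsub>with_proj G\<^esub> w"
      using ancestors_comparable u w unfolding A_def by blast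
    have "u \<in> below u"
      using u A_verts by (auto simp: below_def)
    then have "below w \<subset> below u"
      using nw uw reachable_trans by (auto simp: below_def)
    moreover have "finite (below u)"
      using finite_A by (simp add: below_def)
    ultimately have "card (below w) < card (below u)"
      by (simp add: psubset_card_mono)
    then show False
      using min[OF w] by simp
  qed
  then show ?thesis using u unfolding A_def by blast
qed

lemma
  assumes "x \<in> pverts G" "y \<in> pverts G"
  shows lca_reaches_left: "lca G x y \<rightarrow>\<^sup>*\<^bsub>with_proj G\<^esub> x"
    and lca_reaches_right: "lca G x y \<rightarrow>\<^sup>*\<^bsub>with_proj G\<^esub> y"
    and lca_greatest:
      "w \<rightarrow>\<^sup>*\<^bsub>with_proj G\<^esub> x \<Longrightarrow> w \<rightarrow>\<^sup>*\<^bsub>with_proj G\<^esub> y \<Longrightarrow> w \<rightarrow>\<^sup>*\<^bsub>with_proj G\<^esub> lca G x y"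
proof -
  have "\<exists>!u. u \<rightarrow>\<^sup>*\<^bsub>with_proj G\<^esub> x \<and> u \<rightarrow>\<^sup>*\<^bsub>with_proj G\<^esub> y \<and>
     (\<forall>w. w \<rightarrow>\<^sup>*\<^bsub>with_proj G\<^esub> x \<and> w \<rightarrow>\<^sup>*\<^bsub>with_proj G\<^esub> y \<longrightarrow> w \<rightarrow>\<^sup>*\<^bsub>with_proj G\<^esub> u)"
    using lca_exists[OF assms] reachable_antisym by blast
  note * = theI'[OF this, folded lca_def]
  show "lca G x y \<rightarrow>\<^sup>*\<^bsub>with_proj G\<^esub> x" "lca G x y \<rightarrow>\<^sup>*\<^bsub>with_proj G\<^esub> y"
    and "w \<rightarrow>\<^sup>*\<^bsub>with_proj G\<^esub> x \<Longrightarrow> w \<rightarrow>\<^sup>*\<^bsub>with_proj G\<^esub> y \<Longrightarrow> w \<rightarrow>\<^sup>*\<^bsub>with_proj G\<^esub> lca G x y"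
    using * by blast+
qed

lemma marked_lca_walk:
  assumes verts: "a \<in> pverts G" "b \<in> pverts G" "c \<in> pverts G"
    and ab: "awalk (lca G a b) p b" "\<exists>e \<in> set p. P e"
    and cb: "\<And>q. awalk (lca G c b) q b \<Longrightarrow> \<not> (\<exists>e \<in> set q. P e)"
  shows "\<exists>q. awalk (lca G a c) q c \<and> (\<exists>e \<in> set q. P e)"
proof -
  define U V W where "U = lca G a b" and "V = lca G c b" and "W = lca G a c"
  have Ua: "U \<rightarrow>\<^sup>*\<^bsub>with_proj G\<^esub> a" and Ub: "U \<rightarrow>\<^sup>*\<^bsub>with_proj G\<^esub> b"
    and Vc: "V \<rightarrow>\<^sup>*\<^bsub>with_proj G\<^esub> c" and Vb: "V \<rightarrow>\<^sup>*\<^bsub>with_proj G\<^esub> b"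
    and Wa: "W \<rightarrow>\<^sup>*\<^bsub>with_proj G\<^esub> a" and Wc: "W \<rightarrow>\<^sup>*\<^bsub>with_proj G\<^esub> c"
    unfolding U_def V_def W_def
    using verts by (auto intro: lca_reaches_left lca_reaches_right)
  have not_VU: "\<not> V \<rightarrow>\<^sup>*\<^bsub>with_proj G\<^esub> U"
  proof
    assume "V \<rightarrow>\<^sup>*\<^bsub>with_proj G\<^esub> U"
    then obtain s where "awalk V s U"
      using reachable_awalk by blast
    then have "awalk V (s @ p) b"
      using ab(1) U_def awalk_appendI by blast
    then show False
      using cb[of "s @ p"] ab(2) V_def by auto
  qed
  have "U \<rightarrow>\<^sup>*\<^bsub>with_proj G\<^esub> V"
    using ancestors_comparable[OF Ub Vb] not_VU by blast
  then obtain s where s: "awalk U s V"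
    using reachable_awalk by blast
  obtain t where t: "awalk V t b"
    using Vb reachable_awalk by blast
  have "p = s @ t"
    using s t ab(1) U_def awalk_appendI awalk_unique by blast
  then have marked: "\<exists>e \<in> set s. P e"
    using ab(2) cb t V_def by auto
  have "\<not> V \<rightarrow>\<^sup>*\<^bsub>with_proj G\<^esub> W"
    using not_VU lca_greatest[OF verts(1,2)] Vb Wa reachable_trans U_def by blast
  then have "W \<rightarrow>\<^sup>*\<^bsub>with_proj G\<^esub> b"
    using ancestors_comparable[OF Vc Wc] Vb reachable_trans by blast
  then have "W \<rightarrow>\<^sup>*\<^bsub>with_proj G\<^esub> U"
    using lca_greatest[OF verts(1,2)] Wa U_def by blast
  then obtain q1 q2 where "awalk W q1 U" "awalk V q2 c"
    using Vc reachable_awalk by blast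
  then have "awalk W (q1 @ s @ q2) c"
    using s awalk_appendI by blast
  then show ?thesis
    using marked unfolding W_def by (intro exI[of _ "q1 @ s @ q2"]) auto
qed

end

lemma rooted_tree_iff_arborescence: "rooted_tree T r \<longleftrightarrow> arborescence T r"
  by (auto simp: rooted_tree_def arborescence_def arborescence_axioms_def)

lemma phylogenetic_tree_leaf_set: "phylogenetic_tree T r X \<Longrightarrow> X \<subseteq> pverts T"
  by (auto simp: phylogenetic_tree_def leaves_def)

lemma restricted_fitch_map_triangle:
  assumes "restricted_fitch_map k f"
    and leaf: "a \<in> leaf_set f" "b \<in> leaf_set f" "c \<in> leaf_set f"
    and distinct: "a \<noteq> b" "b \<noteq> c" "a \<noteq> c"
    and m: "m \<in> colors f" "m \<in> eps f (a, b)" "m \<notin> eps f (c, b)"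
  shows "m \<in> eps f (a, c)"
proof -
  obtain T r l where T: "phylogenetic_tree T r (leaf_set f)" and ex: "explains T l f"
    using assms(1) by (auto simp: restricted_fitch_map_def edge_labeled_tree_def)
  interpret arborescence T r
    using T by (simp add: phylogenetic_tree_def rooted_tree_iff_arborescence)
  have ex': "m \<in> eps f (x, y) \<longleftrightarrow> (\<exists>p. awalk (lca T x y) p y \<and> (\<exists>e \<in> set p. m \<in> l e))"
    if "x \<in> leaf_set f" "y \<in> leaf_set f" "x \<noteq> y" for x y
    using ex that m(1) by (auto simp: explains_def irr_def)
  have verts: "a \<in> pverts T" "b \<in> pverts T" "c \<in> pverts T"
    using phylogenetic_tree_leaf_set[OF T] leaf by auto
  obtain p where "awalk (lca T a b) p b" "\<exists>e \<in> set p. m \<in> l e"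
    using ex'[OF leaf(1,2)] distinct m(2) by blast
  moreover have "\<And>q. awalk (lca T c b) q b \<Longrightarrow> \<not> (\<exists>e \<in> set q. m \<in> l e)"
    using ex'[OF leaf(3,2)] distinct m(3) by blast
  ultimately show ?thesis
    using marked_lca_walk[OF verts, where P = "\<lambda>e. m \<in> l e"] ex'[OF leaf(1,3)] distinct by blast
qed

definition star :: "'v \<Rightarrow> 'v set \<Rightarrow> 'v pair_pre_digraph" where
  "star r X = \<lparr>pverts = insert r X, parcs = {r} \<times> X\<rparr>"

lemma star_simps [simp]: "pverts (star r X) = insert r X" "parcs (star r X) = {r} \<times> X"
  by (simp_all add: star_def)

lemma star_awalk_iff:
  assumes "r \<notin> X"
  shows "pre_digraph.awalk (with_proj (star r X)) u p v \<longleftrightarrow>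
     p = [] \<and> u = v \<and> u \<in> insert r X \<or> p = [(r, v)] \<and> u = r \<and> v \<in> X"
proof (cases p)
  case Nil
  then show ?thesis by (auto simp: pre_digraph.awalk_def cas_with_proj_eq)
next
  case (Cons e q)
  then show ?thesis
    using assms by (cases q) (auto simp: pre_digraph.awalk_def cas_with_proj_eq)
qed

lemma star_arborescence:
  assumes "finite X" "r \<notin> X"
  shows "arborescence (star r X) r"
  by unfold_locales (use assms in \<open>auto simp: star_awalk_iff\<close>)

lemma vdegree_star:
  assumes "r \<notin> X"
  shows "vdegree (star r X) r = card X" and "x \<in> X \<Longrightarrow> vdegree (star r X) x = 1"
proof -
  have "in_arcs (with_proj (star r X)) r = {}" "out_arcs (with_proj (star r X)) r = {r} \<times> X"
    using assms by (auto simp: in_arcs_def out_arcs_def)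
  then show "vdegree (star r X) r = card X"
    by (simp add: vdegree_def in_degree_def out_degree_def card_cartesian_product)
  show "vdegree (star r X) x = 1" if "x \<in> X"
  proof -
    have "in_arcs (with_proj (star r X)) x = {(r, x)}" "out_arcs (with_proj (star r X)) x = {}"
      using assms that by (auto simp: in_arcs_def out_arcs_def)
    then show ?thesis
      by (simp add: vdegree_def in_degree_def out_degree_def)
  qed
qed

lemma star_phylogenetic_tree:
  assumes "finite X" "r \<notin> X" "2 \<le> card X"
  shows "phylogenetic_tree (star r X) r X"
proof -
  have "leaves (star r X) r = X"
    using assms vdegree_star by (auto simp: leaves_def)
  then show ?thesis
    using assms vdegree_star(1)[OF assms(2)] star_arborescence[OF assms(1,2)]
    by (auto simp: phylogenetic_tree_def rooted_tree_iff_arborescence)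
qed

lemma constant_map_restricted_fitch:
  fixes X :: "'x::infinite set"
  assumes X: "finite X" "2 \<le> card X" and M: "finite M" "M \<noteq> {}" "card M \<le> k"
  shows "restricted_fitch_map k \<lparr>leaf_set = X, colors = M, eps = restrict (\<lambda>_. M) (irr X)\<rparr>"
proof -
  obtain r where r: "r \<notin> X"
    using ex_new_if_finite[OF infinite_UNIV X(1)] by blast
  interpret arborescence "star r X" r
    by (rule star_arborescence[OF X(1) r])
  have "\<exists>p. awalk (lca (star r X) x y) p y \<and> p \<noteq> []" if xy: "x \<in> X" "y \<in> X" "x \<noteq> y" for x y
  proof -
    obtain p q where p: "awalk (lca (star r X) x y) p y" and q: "awalk (lca (star r X) x y) q x"
      using xy lca_reaches_left[of x y] lca_reaches_right[of x y]
      by (auto simp: reachable_awalk)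
    have "p \<noteq> []"
      using p q r xy by (auto simp: star_awalk_iff)
    then show ?thesis using p by blast
  qed
  then have "explains (star r X) (\<lambda>_. M)
      \<lparr>leaf_set = X, colors = M, eps = restrict (\<lambda>_. M) (irr X)\<rparr>"
    by (auto simp: explains_def irr_def neq_Nil_conv) (metis list.set_intros(1))
  moreover have "X \<noteq> {}" using X(2) by auto
  ultimately show ?thesis
    using X M star_phylogenetic_tree[OF X(1) r X(2)]
    unfolding restricted_fitch_map_def edge_labeled_tree_def is_pair_map_def
    by (intro conjI exI[of _ "star r X"] exI[of _ r] exI[of _ "\<lambda>_. M"]) auto
qed

lemma irr_mono: "X \<subseteq> Y \<Longrightarrow> irr X \<subseteq> irr Y"
  by (auto simp: irr_def)

lemma submap_trans:
  assumes "submap g f" "submap f h"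
  shows "submap g h"
proof -
  have "irr (leaf_set g) \<subseteq> irr (leaf_set f)"
    using assms(1) by (simp add: submap_def irr_mono)
  then show ?thesis
    using assms unfolding submap_def by blast
qed

theorem theorem5:
  fixes k :: nat
  assumes "k \<ge> 1"
  shows "\<not> (\<exists>F :: ('x::infinite, 'm::infinite) pair_map set.
           (\<forall>g \<in> F. is_pair_map g) \<and>
           (\<forall>f. is_pair_map f \<longrightarrow>
              (restricted_fitch_map k f \<longleftrightarrow> \<not> (\<exists>g \<in> F. submap g f))))"
proof
  assume "\<exists>F :: ('x, 'm) pair_map set.
           (\<forall>g \<in> F. is_pair_map g) \<and>
           (\<forall>f. is_pair_map f \<longrightarrow>
              (restricted_fitch_map k f \<longleftrightarrow> \<not> (\<exists>g \<in> F. submap g f)))"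
  then obtain F :: "('x, 'm) pair_map set" where
    F: "\<And>f. is_pair_map f \<Longrightarrow> restricted_fitch_map k f \<longleftrightarrow> \<not> (\<exists>g \<in> F. submap g f)"
    by blast
  obtain X :: "'x set" where X: "finite X" "card X = 3"
    using infinite_arbitrarily_large[OF infinite_UNIV] by blast
  then obtain a b c where abc: "X = {a, b, c}" "a \<noteq> b" "b \<noteq> c" "a \<noteq> c"
    by (auto simp: card_3_iff)
  obtain m :: 'm where True
    by blast
  define h where "h = \<lparr>leaf_set = X, colors = {m}, eps = restrict (\<lambda>_. {m}) (irr X)\<rparr>"
  define f where "f = \<lparr>leaf_set = X, colors = {m},
    eps = restrict (\<lambda>e. if e = (a, b) then {m} else {}) (irr X)\<rparr>"
  have h: "restricted_fitch_map k h"
    unfolding h_def using X assms by (intro constant_map_restricted_fitch) auto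
  have "is_pair_map f"
    using X abc by (auto simp: f_def is_pair_map_def)
  moreover have "\<not> restricted_fitch_map k f"
  proof
    assume "restricted_fitch_map k f"
    then have "m \<in> eps f (a, c)"
      by (rule restricted_fitch_map_triangle) (use abc in \<open>auto simp: f_def irr_def\<close>)
    then show False using abc by (auto simp: f_def irr_def)
  qed
  ultimately obtain g where "g \<in> F" "submap g f"
    using F by blast
  moreover have "submap f h"
    by (auto simp: f_def h_def submap_def)
  ultimately have "\<exists>g \<in> F. submap g h"
    using submap_trans by blast
  then show False
    using F h restricted_fitch_map_def by blast
qed

end
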